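(* Let $\alpha>0$, $\bar u>0$, $0<\lambda\le1$, let $k\in\{1,\ldots,N\}$, let $q_k=\frac{1-\lambda}{2}\bar u\,w_k\ge0$, and let $\mathbf z_k\in\mathbb R^3$ with $r_k=\lVert\mathbf z_k\rVert_2$. Then the minimization problem $$\min_{\mathbf u\in\mathbb R^3,\ \lVert\mathbf u\rVert_2\le\bar u}\ \frac12\lVert\mathbf u-\mathbf z_k\rVert_2^2+\alpha q_k\lVert\mathbf u\rVert_2$$ has a unique solution, denoted $\operatorname{prox}_{\alpha g_k}(\mathbf z_k)$, and it is $$\operatorname{prox}_{\alpha g_k}(\mathbf z_k)=\begin{cases}\dfrac{\hat r_k}{r_k}\,\mathbf z_k,& r_k>0,\\[2mm] \mathbf 0,& r_k=0,\end{cases}\qquad\text{where}\qquad \hat r_k=\min\{\max(r_k-\alpha q_k,0),\bar u\}.$$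
   Context: $N\ge2$ is an integer and $w_1=w_N=\tfrac12$, $w_k=1$ for $2\le k\le N-1$. The function $g_k:\mathbb R^3\to\mathbb R\cup\{+\infty\}$ is $g_k(\mathbf u)=q_k\lVert\mathbf u\rVert_2+\mathcal I_{\{\lVert\mathbf u\rVert_2\le\bar u\}}(\mathbf u)$, where $\mathcal I$ is the convex-analysis indicator function ($0$ on the set, $+\infty$ outside), and $\operatorname{prox}_{\alpha g_k}(\mathbf z)=\arg\min_{\mathbf u}\frac12\lVert\mathbf u-\mathbf z\rVert_2^2+\alpha g_k(\mathbf u)$ is its proximal operator. *)

theory Defs
  imports "HOL-Analysis.Analysis"
begin

definition quad_weight :: "nat \<Rightarrow> nat \<Rightarrow> real" where
  "quad_weight N k = (if k = 1 \<or> k = N then 1/2 else 1)"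

text \<open>Indicator function in the sense of convex analysis, as opposed to the
  library's 0/1-valued \<^const>\<open>indicator\<close>.\<close>

definition convex_indicator :: "'a set \<Rightarrow> 'a \<Rightarrow> ereal" where
  "convex_indicator S u = (if u \<in> S then 0 else \<infinity>)"

definition norm_ball_fun :: "real \<Rightarrow> real \<Rightarrow> 'a::real_normed_vector \<Rightarrow> ereal" where
  "norm_ball_fun q ubar u = ereal (q * norm u) + convex_indicator {v. norm v \<le> ubar} u"

text \<open>The value is meaningful only when the minimizer exists and is unique.
  Scaling is left to the argument: the proximal operator of \<open>\<alpha> g\<close>
  is that of \<open>\<lambda>u. ereal \<alpha> * g u\<close>.\<close>

definition prox :: "('a::real_normed_vector \<Rightarrow> ereal) \<Rightarrow> 'a \<Rightarrow> 'a" where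
  "prox f z = (THE u. is_arg_min (\<lambda>v. ereal (1/2 * (norm (v - z))\<^sup>2) + f v) (\<lambda>_. True) u)"

end

theory Submission
  imports Defs
begin

text \<open>Write \<open>r = \<parallel>z\<parallel>\<close> and \<open>c = \<alpha> q\<close>. The candidate \<open>p = \<rho> *\<^sub>R sgn z\<close> minimizes the 1-strongly convex objective because
  every feasible \<open>u\<close> obeys the quadratic growth bound
  \<open>F u - F p \<ge> \<parallel>u - p\<parallel>\<^sup>2 / 2\<close>, which also gives uniqueness. After expanding the square, the
  bound reduces by Cauchy--Schwarz to the scalar variational inequality
  \<open>(c - (r - \<rho>)) (\<parallel>u\<parallel> - \<rho>) \<ge> 0\<close>, where \<open>\<rho>\<close> is the projection of \<open>r - c\<close>
  onto the interval from \<open>0\<close> to the radius of the ball.\<close>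

text \<open>The clamp is the projection of \<open>a\<close> onto the interval from 0 to
  \<open>b\<close>. If \<open>a\<close> lies outside, the clamp is the nearest endpoint and the two
  factors cannot have opposite signs; if \<open>a\<close> lies inside, the first factor
  vanishes.\<close>

lemma clamp_variational_inequality:
  fixes a b t :: real
  assumes "0 \<le> t" and "t \<le> b"
  shows "(min (max a 0) b - a) * (t - min (max a 0) b) \<ge> 0"
proof -
  consider "a \<le> 0" | "0 \<le> a" "a \<le> b" | "b \<le> a" "0 \<le> a"
    by linarith
  then show ?thesis
  proof cases
    case 1
    then show ?thesis using assms by (simp add: mult_nonpos_nonneg)
  next
    case 2
    then show ?thesis by simp
  next
    case 3
    then show ?thesis using assms by (simp add: mult_nonpos_nonpos)
  qed
qed

lemma quadratic_growth_imp_unique_is_arg_min: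
  fixes F :: "'a::real_normed_vector \<Rightarrow> real"
  assumes "P p" and growth: "\<And>u. P u \<Longrightarrow> F u \<ge> F p + 1/2 * (norm (u - p))\<^sup>2"
  shows "is_arg_min F P u \<longleftrightarrow> u = p"
proof
  assume u: "is_arg_min F P u"
  then have "P u" "F u \<le> F p"
    using \<open>P p\<close> by (auto simp: is_arg_min_def not_less)
  with growth[of u] have "(norm (u - p))\<^sup>2 \<le> 0" by linarith
  then have "norm (u - p) = 0"
    by (simp only: power2_less_eq_zero_iff)
  then show "u = p" by simp
next
  assume "u = p"
  moreover have "F p \<le> F v" if "P v" for v
    using growth[OF that] zero_le_power2[of "norm (v - p)"] by linarith
  ultimately show "is_arg_min F P u"
    using \<open>P p\<close> by (auto simp: is_arg_min_def not_less)
qed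

lemma norm_prox_quadratic_growth:
  fixes z u :: "'a::real_inner" and c b :: real
  defines "\<rho> \<equiv> min (max (norm z - c) 0) b"
  assumes "c \<ge> 0" and "b \<ge> 0" and "norm u \<le> b"
  shows "1/2 * (norm (u - z))\<^sup>2 + c * norm u
    \<ge> 1/2 * (norm (\<rho> *\<^sub>R sgn z - z))\<^sup>2 + c * norm (\<rho> *\<^sub>R sgn z)
      + 1/2 * (norm (u - \<rho> *\<^sub>R sgn z))\<^sup>2"
proof -
  define p where "p = \<rho> *\<^sub>R sgn z"
  \<comment> \<open>The upper bound rests on \<open>c \<ge> 0\<close>. It makes the factor
    \<open>norm z - \<rho>\<close> in the Cauchy-Schwarz step nonnegative and forces
    \<open>\<rho> = 0\<close> when \<open>z = 0\<close>.\<close>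
  have \<rho>: "0 \<le> \<rho>" "\<rho> \<le> norm z"
    using assms by (simp_all add: \<rho>_def min.coboundedI1)
  have norm_p: "norm p = \<rho>"
    using \<rho> by (auto simp: p_def norm_sgn)
  have "norm z *\<^sub>R sgn z = z"
    by (cases "z = 0") (simp_all add: sgn_div_norm)
  then have diff: "p - z = - (norm z - \<rho>) *\<^sub>R sgn z"
    by (simp add: p_def scaleR_diff_left)
  have sgn_p: "sgn z \<bullet> p = \<rho>"
    using \<rho> by (cases "z = 0") (auto simp: p_def norm_sgn simp flip: power2_norm_eq_inner)
  have "sgn z \<bullet> u \<le> norm (sgn z) * norm u"
    by (rule norm_cauchy_schwarz)
  also have "\<dots> \<le> norm u"
    by (simp add: norm_sgn)
  finally have "(norm z - \<rho>) * (sgn z \<bullet> u) \<le> (norm z - \<rho>) * norm u"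
    using \<rho> by (intro mult_left_mono) auto
  then have cross: "(p - z) \<bullet> (u - p) \<ge> - (norm z - \<rho>) * (norm u - \<rho>)"
    unfolding diff by (simp add: inner_diff_right sgn_p algebra_simps)
  have "(\<rho> - (norm z - c)) * (norm u - \<rho>) \<ge> 0"
    unfolding \<rho>_def using \<open>norm u \<le> b\<close> by (intro clamp_variational_inequality) auto
  \<comment> \<open>The lower bound in \<open>cross\<close> plus
    \<open>c * (norm u - \<rho>)\<close> is exactly the product in the scalar inequality.\<close>
  with cross have "(p - z) \<bullet> (u - p) + c * (norm u - norm p) \<ge> 0"
    by (simp add: norm_p algebra_simps)
  \<comment> \<open>Expansion along \<open>u - z = (u - p) + (p - z)\<close>.\<close>
  moreover have "(norm (u - z))\<^sup>2
      = (norm (u - p))\<^sup>2 + 2 * ((p - z) \<bullet> (u - p)) + (norm (p - z))\<^sup>2"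
    by (simp add: power2_norm_eq_inner inner_diff_left inner_diff_right inner_commute algebra_simps)
  ultimately show ?thesis
    unfolding p_def[symmetric] by (simp add: algebra_simps)
qed

lemma is_arg_min_norm_ball_iff:
  fixes z u :: "'a::real_inner" and c b :: real
  assumes "c \<ge> 0" and "b \<ge> 0"
  shows "is_arg_min (\<lambda>v. 1/2 * (norm (v - z))\<^sup>2 + c * norm v) (\<lambda>v. norm v \<le> b) u
    \<longleftrightarrow> u = min (max (norm z - c) 0) b *\<^sub>R sgn z"
proof (rule quadratic_growth_imp_unique_is_arg_min)
  show "norm (min (max (norm z - c) 0) b *\<^sub>R sgn z) \<le> b"
    using assms by (auto simp: norm_sgn)
qed (use norm_prox_quadratic_growth assms in blast)

text \<open>A feasible point has a finite value, so no point with value \<infinity> can be a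
  minimizer.\<close>

lemma is_arg_min_extended_iff:
  fixes F :: "'a \<Rightarrow> real"
  assumes "\<exists>v. P v"
  shows "is_arg_min (\<lambda>v. if P v then ereal (F v) else \<infinity>) (\<lambda>_. True) u \<longleftrightarrow> is_arg_min F P u"
  using assms by (auto simp: is_arg_min_def)

lemma prox_norm_ball_fun:
  fixes z :: "'a::real_inner"
  assumes "\<alpha> > 0" and "q \<ge> 0" and "b \<ge> 0"
  shows "prox (\<lambda>v. ereal \<alpha> * norm_ball_fun q b v) z
    = min (max (norm z - \<alpha> * q) 0) b *\<^sub>R sgn z"
proof -
  \<comment> \<open>Since \<open>\<alpha> > 0\<close>, scaling keeps the value \<infinity> outside
    the ball.\<close>
  have objective: "(\<lambda>v. ereal (1/2 * (norm (v - z))\<^sup>2) + ereal \<alpha> * norm_ball_fun q b v)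
      = (\<lambda>v. if norm v \<le> b then ereal (1/2 * (norm (v - z))\<^sup>2 + \<alpha> * q * norm v) else \<infinity>)"
    using assms by (auto simp: norm_ball_fun_def convex_indicator_def fun_eq_iff)
  have "\<exists>v::'a. norm v \<le> b"
    using assms by (intro exI[of _ 0]) simp
  note extended = is_arg_min_extended_iff[of "\<lambda>v. norm v \<le> b", OF this]
  have "\<alpha> * q \<ge> 0"
    using assms by simp
  then show ?thesis
    \<comment> \<open>Being a minimizer becomes an equation for \<open>u\<close>, so the definite
      description evaluates directly.\<close>
    unfolding prox_def objective extended
    by (simp only: is_arg_min_norm_ball_iff[OF _ \<open>b \<ge> 0\<close>] the_eq_trivial)
qed

theorem proposition3:
  fixes N k :: nat and \<alpha> ubar lam q r rhat :: real and z :: "real ^ 3"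
  assumes "N \<ge> 2"
    and "\<alpha> > 0" and "ubar > 0" and "0 < lam" and "lam \<le> 1"
    and "k \<in> {1..N}"
    and "q = (1 - lam) / 2 * ubar * quad_weight N k"
    and "r = norm z"
    and "rhat = min (max (r - \<alpha> * q) 0) ubar"
  shows "q \<ge> 0
    \<and> (\<exists>!u :: real ^ 3. is_arg_min (\<lambda>v. 1/2 * (norm (v - z))\<^sup>2 + \<alpha> * q * norm v)
           (\<lambda>v. norm v \<le> ubar) u)
    \<and> is_arg_min (\<lambda>v. 1/2 * (norm (v - z))\<^sup>2 + \<alpha> * q * norm v) (\<lambda>v. norm v \<le> ubar)
           (prox (\<lambda>v. ereal \<alpha> * norm_ball_fun q ubar v) z)
    \<and> prox (\<lambda>v. ereal \<alpha> * norm_ball_fun q ubar v) z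
           = (if r > 0 then (rhat / r) *\<^sub>R z else 0)"
proof -
  have q: "q \<ge> 0"
    unfolding \<open>q = _\<close> using assms(3,5)
    by (intro mult_nonneg_nonneg) (auto simp: quad_weight_def)
  have c: "\<alpha> * q \<ge> 0" and b: "ubar \<ge> 0"
    using q assms by auto
  \<comment> \<open>Both cases merge because \<open>sgn 0 = 0\<close>.\<close>
  have formula: "(if r > 0 then (rhat / r) *\<^sub>R z else 0) = rhat *\<^sub>R sgn z"
    unfolding \<open>r = _\<close> by (simp add: sgn_div_norm divide_inverse)
  have rhat: "min (max (norm z - \<alpha> * q) 0) ubar = rhat"
    using assms(8,9) by (simp only:)
  show ?thesis
    unfolding is_arg_min_norm_ball_iff[OF c b] prox_norm_ball_fun[OF \<open>\<alpha> > 0\<close> q b] formula rhat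
    using q by blast
qed

end
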